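(* Let $n\ge 1$ and let $\mu_n$ be the multiplicative measure on $\Omega_n$ determined by the probabilities $\{a^{(j)}_k\}$. Let $u_c,u_f$ be coagulation and fragmentation transition rates on $\Omega_n$, and let $$q(\eta;i,j)=\frac{u_c(\eta,\eta^{(i,j)})}{u_f(\eta^{(i,j)},\eta)}.$$ If for all $\eta=(k_1,\dots,k_n)\in\Omega_n$ and all admissible $i,j$ $$q(\eta;i,j)=\begin{cases}\dfrac{a^{(i)}_{k_i-1}\,a^{(j)}_{k_j-1}\,a^{(i+j)}_{k_{i+j}+1}}{a^{(i)}_{k_i}\,a^{(j)}_{k_j}\,a^{(i+j)}_{k_{i+j}}}, & \text{if } i\ne j,\ k_i,k_j>0,\\[3mm] \dfrac{a^{(i)}_{k_i-2}\,a^{(2i)}_{k_{2i}+1}}{a^{(i)}_{k_i}\,a^{(2i)}_{k_{2i}}}, & \text{if } i=j,\ k_i\ge 2\end{cases}$$ (all quotients being understood to be well defined, i.e. to have nonzero denominators), then $\mu_n$ is reversible with respect to the transition rates $u_c,u_f$.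
   Context: $\Omega_n=\{\eta=(k_1,\dots,k_n):\ k_j\in\mathbb{Z}_{\ge 0},\ \sum_{j=1}^n jk_j=n\}$ is the set of partitions of $n$; $k_j$ is the number of clusters of size $j$. Let $\{Z_j,\ j\ge 1\}$ be independent random variables with values in the nonnegative integers, $a^{(j)}_k=\mathbb{P}(Z_j=k)$, and assume $c_n=\mathbb{P}(\sum_{j=1}^n jZ_j=n)>0$. The multiplicative measure $\mu_n$ is the probability measure on $\Omega_n$ given by $\mu_n(\eta)=c_n^{-1}\prod_{j=1}^n a^{(j)}_{k_j}$ for $\eta=(k_1,\dots,k_n)\in\Omega_n$. A coagulation-fragmentation process is a continuous-time Markov chain on $\Omega_n$ whose only possible transitions are the following. Coagulation: for $\eta$ with $k_i,k_j>0$ if $i\neq j$ (respectively $k_i\ge 2$ if $i=j$), the state $\eta^{(i,j)}$ is obtained from $\eta$ by merging a cluster of size $i$ and a cluster of size $j$ into one cluster of size $i+j$; the rate of $\eta\to\eta^{(i,j)}$ is $u_c(\eta,\eta^{(i,j)})$. Fragmentation: for $\eta$ with $k_{i+j}>0$, the state $\eta_{(i,j)}$ is obtained from $\eta$ by splitting a cluster of size $i+j$ into two clusters of sizes $i$ and $j$; the rate of $\eta\to\eta_{(i,j)}$ is $u_f(\eta,\eta_{(i,j)})$. $\mu_n$ is reversible with respect to $u_c,u_f$ if the detailed balance condition $\mu_n(\eta)\,u_c(\eta,\eta^{(i,j)})=\mu_n(\eta^{(i,j)})\,u_f(\eta^{(i,j)},\eta)$ holds for all $\eta\in\Omega_n$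 and all $i,j$ for which $\eta^{(i,j)}$ is defined. *)

theory Defs
  imports "HOL-Probability.Probability"
begin

text \<open>A state \<open>(k\<^sub>1, \<dots>, k\<^sub>n)\<close> is a function \<open>\<eta>\<close> with \<open>\<eta> j = k\<^sub>j\<close> for \<open>1 \<le> j \<le> n\<close> that
  vanishes outside \<open>{1..n}\<close>, so that each partition of \<open>n\<close> is represented exactly once.\<close>

definition partitions_of :: "nat \<Rightarrow> (nat \<Rightarrow> nat) set" where
  "partitions_of n = {\<eta>. (\<forall>j. j \<notin> {1..n} \<longrightarrow> \<eta> j = 0) \<and> (\<Sum>j=1..n. j * \<eta> j) = n}"

definition point_prob :: "'a measure \<Rightarrow> (nat \<Rightarrow> 'a \<Rightarrow> nat) \<Rightarrow> nat \<Rightarrow> nat \<Rightarrow> real" where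
  "point_prob M Z j k = measure M {\<omega> \<in> space M. Z j \<omega> = k}"

definition norm_const :: "'a measure \<Rightarrow> (nat \<Rightarrow> 'a \<Rightarrow> nat) \<Rightarrow> nat \<Rightarrow> real" where
  "norm_const M Z n = measure M {\<omega> \<in> space M. (\<Sum>j=1..n. j * Z j \<omega>) = n}"

definition mult_measure :: "'a measure \<Rightarrow> (nat \<Rightarrow> 'a \<Rightarrow> nat) \<Rightarrow> nat \<Rightarrow> (nat \<Rightarrow> nat) measure" where
  "mult_measure M Z n = point_measure (partitions_of n)
     (\<lambda>\<eta>. ennreal (inverse (norm_const M Z n) * (\<Prod>j=1..n. point_prob M Z j (\<eta> j))))"

lemma finite_partitions_of: "finite (partitions_of n)"
proof -
  have "partitions_of n \<subseteq> {f. \<forall>j. (j \<in> {1..n} \<longrightarrow> f j \<in> {0..n}) \<and> (j \<notin> {1..n} \<longrightarrow> f j = 0)}"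
  proof safe
    fix \<eta> j assume \<eta>: "\<eta> \<in> partitions_of n"
    { assume j: "j \<in> {1..n}"
      have "j * \<eta> j \<le> (\<Sum>j=1..n. j * \<eta> j)"
        using j by (intro member_le_sum) auto
      also have "\<dots> = n" using \<eta> by (simp add: partitions_of_def)
      finally have "j * \<eta> j \<le> n" .
      moreover have "\<eta> j \<le> j * \<eta> j" using j mult_le_mono1[of 1 j "\<eta> j"] by simp
      ultimately have "\<eta> j \<le> n" by (rule order_trans[rotated])
      then show "\<eta> j \<in> {0..n}" by simp }
    { assume "j \<notin> {1..n}"
      then show "\<eta> j = 0" using \<eta> by (simp add: partitions_of_def) }
  qed
  moreover have "finite {f. \<forall>j. (j \<in> {1..n} \<longrightarrow> f j \<in> {0..n}) \<and> (j \<notin> {1..n} \<longrightarrow> f j = (0::nat))}"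
    by (intro finite_set_of_finite_funs) auto
  ultimately show ?thesis by (rule finite_subset)
qed

lemma prob_space_mult_measure:
  assumes "prob_space M"
    and indep: "prob_space.indep_vars M (\<lambda>_. count_space UNIV) Z {1..}"
    and c: "norm_const M Z n > 0"
  shows "prob_space (mult_measure M Z n)"
proof -
  interpret prob_space M by fact
  have rv: "Z j \<in> measurable M (count_space UNIV)" if "j \<ge> 1" for j
    using indep that by (simp add: indep_vars_def2)
  let ?E = "\<lambda>\<eta>. {\<omega> \<in> space M. \<forall>j\<in>{1..n}. Z j \<omega> = \<eta> j}"
  have E_sets: "?E \<eta> \<in> events" for \<eta>
    by (rule sets.sets_Collect_finite_All) (auto intro!: measurable_sets_Collect[OF rv])
  have E_prob: "prob (?E \<eta>) = (\<Prod>j=1..n. point_prob M Z j (\<eta> j))" for \<eta>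
  proof (cases "n = 0")
    case True
    then show ?thesis by (simp add: prob_space)
  next
    case False
    have "prob (\<Inter>j\<in>{1..n}. Z j -` {\<eta> j} \<inter> space M) = (\<Prod>j=1..n. prob (Z j -` {\<eta> j} \<inter> space M))"
      using False
      by (intro indep_varsD[OF indep]) auto
    moreover have "(\<Inter>j\<in>{1..n}. Z j -` {\<eta> j} \<inter> space M) = ?E \<eta>"
      using False by auto
    moreover have "Z j -` {\<eta> j} \<inter> space M = {\<omega> \<in> space M. Z j \<omega> = \<eta> j}" for j
      by auto
    ultimately show ?thesis by (simp add: point_prob_def)
  qed
  have "norm_const M Z n = prob (\<Union>\<eta>\<in>partitions_of n. ?E \<eta>)"
    unfolding norm_const_def
  proof (rule arg_cong[where f = prob], intro set_eqI iffI)
    fix \<omega> assume w: "\<omega> \<in> {\<omega> \<in> space M. (\<Sum>j=1..n. j * Z j \<omega>) = n}"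
    let ?h = "\<lambda>j. if j \<in> {1..n} then Z j \<omega> else 0"
    have "(\<Sum>j=1..n. j * ?h j) = (\<Sum>j=1..n. j * Z j \<omega>)" by (intro sum.cong) auto
    then have "?h \<in> partitions_of n" using w by (simp add: partitions_of_def)
    moreover have "\<omega> \<in> ?E ?h" using w by simp
    ultimately show "\<omega> \<in> (\<Union>\<eta>\<in>partitions_of n. ?E \<eta>)" by blast
  next
    fix \<omega> assume "\<omega> \<in> (\<Union>\<eta>\<in>partitions_of n. ?E \<eta>)"
    then obtain \<eta> where h: "\<eta> \<in> partitions_of n" "\<omega> \<in> ?E \<eta>" by blast
    have "(\<Sum>j=1..n. j * Z j \<omega>) = (\<Sum>j=1..n. j * \<eta> j)" using h(2) by (intro sum.cong) auto
    then show "\<omega> \<in> {\<omega> \<in> space M. (\<Sum>j=1..n. j * Z j \<omega>) = n}"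
      using h by (simp add: partitions_of_def)
  qed
  also have "\<dots> = (\<Sum>\<eta>\<in>partitions_of n. prob (?E \<eta>))"
  proof (rule finite_measure_finite_Union[OF finite_partitions_of])
    show "?E ` partitions_of n \<subseteq> events" using E_sets by blast
    show "disjoint_family_on ?E (partitions_of n)"
      unfolding disjoint_family_on_def
    proof (intro ballI impI)
      fix f g assume fg: "f \<in> partitions_of n" "g \<in> partitions_of n" "f \<noteq> g"
      then obtain j where j: "f j \<noteq> g j" by blast
      with fg have "j \<in> {1..n}" unfolding partitions_of_def by fastforce
      with j show "?E f \<inter> ?E g = {}" by fastforce
    qed
  qed
  finally have s: "norm_const M Z n = (\<Sum>\<eta>\<in>partitions_of n. \<Prod>j=1..n. point_prob M Z j (\<eta> j))"
    by (simp only: E_prob)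
  have nn: "0 \<le> (\<Prod>j=1..n. point_prob M Z j (\<eta> j))" for \<eta>
    by (intro prod_nonneg) (simp add: point_prob_def)
  show ?thesis
    unfolding mult_measure_def
  proof (rule prob_space_point_measure[OF finite_partitions_of])
    have "(\<Sum>\<eta>\<in>partitions_of n. inverse (norm_const M Z n) *
        (\<Prod>j=1..n. point_prob M Z j (\<eta> j))) = 1"
      using c unfolding sum_distrib_left[symmetric] s[symmetric] by simp
    moreover have "0 \<le> inverse (norm_const M Z n) * (\<Prod>j=1..n. point_prob M Z j (\<eta> j))" for \<eta>
      using c nn by (intro mult_nonneg_nonneg) simp_all
    ultimately show "(\<Sum>\<eta>\<in>partitions_of n. ennreal (inverse (norm_const M Z n) *
        (\<Prod>j=1..n. point_prob M Z j (\<eta> j)))) = 1"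
      by (subst sum_ennreal) simp_all
  qed simp
qed

definition coag_admissible :: "(nat \<Rightarrow> nat) \<Rightarrow> nat \<Rightarrow> nat \<Rightarrow> bool" where
  "coag_admissible \<eta> i j \<longleftrightarrow> 1 \<le> i \<and> 1 \<le> j \<and> (if i = j then \<eta> i \<ge> 2 else \<eta> i > 0 \<and> \<eta> j > 0)"

definition frag_admissible :: "(nat \<Rightarrow> nat) \<Rightarrow> nat \<Rightarrow> nat \<Rightarrow> bool" where
  "frag_admissible \<eta> i j \<longleftrightarrow> 1 \<le> i \<and> 1 \<le> j \<and> \<eta> (i + j) > 0"

text \<open>For \<open>i = j\<close> both indicators below fire at \<open>m = i\<close>, so two clusters of size \<open>i\<close> are removed
  (respectively created). Under admissibility the subtractions are exact.\<close>

definition coag :: "(nat \<Rightarrow> nat) \<Rightarrow> nat \<Rightarrow> nat \<Rightarrow> (nat \<Rightarrow> nat)" where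
  "coag \<eta> i j = (\<lambda>m. \<eta> m - of_bool (m = i) - of_bool (m = j) + of_bool (m = i + j))"

definition frag :: "(nat \<Rightarrow> nat) \<Rightarrow> nat \<Rightarrow> nat \<Rightarrow> (nat \<Rightarrow> nat)" where
  "frag \<eta> i j = (\<lambda>m. \<eta> m - of_bool (m = i + j) + of_bool (m = i) + of_bool (m = j))"

lemma sum_partition:
  assumes "\<eta> \<in> partitions_of n" "A \<subseteq> {1..n}"
  shows "(\<Sum>m\<in>A. m * \<eta> m) \<le> n"
  using sum_mono2[of "{1..n}" A "\<lambda>m. m * \<eta> m"] assms by (simp add: partitions_of_def)

lemma coag_mem:
  assumes h: "\<eta> \<in> partitions_of n" and adm: "coag_admissible \<eta> i j"
  shows "coag \<eta> i j \<in> partitions_of n"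
proof -
  have supp: "m \<in> {1..n}" if "\<eta> m > 0" for m
    using h that unfolding partitions_of_def by force
  have ij: "\<eta> i > 0" "\<eta> j > 0" "i \<ge> 1" "j \<ge> 1"
    using adm by (auto simp: coag_admissible_def split: if_splits)
  then have mem: "i \<in> {1..n}" "j \<in> {1..n}" using supp by blast+
  have le: "i + j \<le> n"
  proof (cases "i = j")
    case True
    then have "i * 2 \<le> i * \<eta> i" using adm by (simp add: coag_admissible_def)
    also have "\<dots> \<le> n" using sum_partition[OF h, of "{i}"] mem by simp
    finally show ?thesis using True by simp
  next
    case False
    have "i + j \<le> i * \<eta> i + j * \<eta> j" using ij by (intro add_mono) auto
    also have "\<dots> \<le> n" using sum_partition[OF h, of "{i,j}"] mem False by simp
    finally show ?thesis .
  qed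
  have "coag \<eta> i j m + (of_bool (m = i) + of_bool (m = j)) = \<eta> m + of_bool (m = i + j)" for m
    using adm by (auto simp: coag_def coag_admissible_def of_bool_def split: if_splits)
  from arg_cong[where f = "\<lambda>x. m * x" for m, OF this]
  have pt: "m * coag \<eta> i j m + (m * of_bool (m = i) + m * of_bool (m = j)) =
      m * \<eta> m + m * of_bool (m = i + j)" for m
    by (simp only: distrib_left)
  have d: "(\<Sum>m=1..n. m * of_bool (m = k)) = k" if "k \<in> {1..n}" for k :: nat
    using that by (simp add: of_bool_def if_distrib[of "\<lambda>x. _ * x"] sum.delta cong: if_cong)
  have "(\<Sum>m=1..n. m * coag \<eta> i j m) + (i + j) = (\<Sum>m=1..n. m * \<eta> m) + (i + j)"
  proof -
    have "(\<Sum>m=1..n. m * coag \<eta> i j m + (m * of_bool (m = i) + m * of_bool (m = j))) =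
      (\<Sum>m=1..n. m * \<eta> m + m * of_bool (m = i + j))" by (simp add: pt)
    then show ?thesis using d[of i] d[of j] d[of "i + j"] mem le ij by (simp add: sum.distrib)
  qed
  then show ?thesis using h le ij unfolding partitions_of_def coag_def by (auto simp: of_bool_def)
qed

lemma frag_coag:
  assumes "coag_admissible \<eta> i j"
  shows "frag_admissible (coag \<eta> i j) i j" "frag (coag \<eta> i j) i j = \<eta>"
  using assms
  by (auto simp: coag_admissible_def frag_admissible_def frag_def coag_def of_bool_def fun_eq_iff split: if_splits)

text \<open>Rates are total functions of two states; they are nonnegative on the state space and are
  zero for pairs of states that are not a coagulation (respectively fragmentation) step.\<close>

definition cf_rates ::
  "nat \<Rightarrow> ((nat \<Rightarrow> nat) \<Rightarrow> (nat \<Rightarrow> nat) \<Rightarrow> real) \<Rightarrow> ((nat \<Rightarrow> nat) \<Rightarrow> (nat \<Rightarrow> nat) \<Rightarrow> real) \<Rightarrow> bool" where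
  "cf_rates n uc uf \<longleftrightarrow>
     (\<forall>\<eta>\<in>partitions_of n. \<forall>\<zeta>\<in>partitions_of n.
        0 \<le> uc \<eta> \<zeta> \<and> 0 \<le> uf \<eta> \<zeta> \<and>
        (uc \<eta> \<zeta> \<noteq> 0 \<longrightarrow> (\<exists>i j. coag_admissible \<eta> i j \<and> \<zeta> = coag \<eta> i j)) \<and>
        (uf \<eta> \<zeta> \<noteq> 0 \<longrightarrow> (\<exists>i j. frag_admissible \<eta> i j \<and> \<zeta> = frag \<eta> i j)))"

definition rate_ratio ::
  "((nat \<Rightarrow> nat) \<Rightarrow> (nat \<Rightarrow> nat) \<Rightarrow> real) \<Rightarrow> ((nat \<Rightarrow> nat) \<Rightarrow> (nat \<Rightarrow> nat) \<Rightarrow> real) \<Rightarrow>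
    (nat \<Rightarrow> nat) \<Rightarrow> nat \<Rightarrow> nat \<Rightarrow> real" where
  "rate_ratio uc uf \<eta> i j = uc \<eta> (coag \<eta> i j) / uf (coag \<eta> i j) \<eta>"

definition reversible_wrt ::
  "(nat \<Rightarrow> nat) measure \<Rightarrow> nat \<Rightarrow> ((nat \<Rightarrow> nat) \<Rightarrow> (nat \<Rightarrow> nat) \<Rightarrow> real) \<Rightarrow>
    ((nat \<Rightarrow> nat) \<Rightarrow> (nat \<Rightarrow> nat) \<Rightarrow> real) \<Rightarrow> bool" where
  "reversible_wrt \<mu> n uc uf \<longleftrightarrow>
     (\<forall>\<eta>\<in>partitions_of n. \<forall>i j. coag_admissible \<eta> i j \<longrightarrow>
        measure \<mu> {\<eta>} * uc \<eta> (coag \<eta> i j) = measure \<mu> {coag \<eta> i j} * uf (coag \<eta> i j) \<eta>)"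

end

theory Submission
  imports Defs
begin

text \<open>Up to the normalising constant, the weight of a state is a product of one factor per
  cluster size, and merging sizes \<open>i\<close> and \<open>j\<close> changes the counts only at
  \<open>i\<close>, \<open>j\<close> and \<open>i + j\<close>. All other factors are shared by both
  states, so the ratio of their weights is formally the quotient of these local factors, which is
  exactly the prescribed value of \<open>q\<close>. The comparison is made in cross-multiplied form
  (\<open>prod_cross_eq\<close>), so the shared factors never have to be nonzero.\<close>

lemma partitions_of_support:
  assumes "\<eta> \<in> partitions_of n" "\<eta> m > 0"
  shows "m \<in> {1..n}"
  using assms unfolding partitions_of_def by force

text \<open>The merged state is again a partition of \<open>n\<close> and contains a cluster of size
  \<open>i + j\<close>; hence \<open>i + j\<close> is at most \<open>n\<close>, and so are
  \<open>i\<close> and \<open>j\<close>.\<close>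

lemma coag_admissible_support:
  assumes "\<eta> \<in> partitions_of n" "coag_admissible \<eta> i j"
  shows "{i, j, i + j} \<subseteq> {1..n}"
proof -
  have "coag \<eta> i j (i + j) > 0"
    by (simp add: coag_def)
  then have "i + j \<in> {1..n}"
    using partitions_of_support[OF coag_mem[OF assms]] by blast
  then show ?thesis
    using assms(2) by (auto simp: coag_admissible_def)
qed

lemma measure_mult_measure_singleton:
  assumes "\<eta> \<in> partitions_of n"
  shows "measure (mult_measure M Z n) {\<eta>} =
    inverse (norm_const M Z n) * (\<Prod>j=1..n. point_prob M Z j (\<eta> j))"
proof -
  \<comment> \<open>Nonnegativity is what allows \<open>ennreal\<close> to be undone when passing
    back to a real-valued measure.\<close>
  have "0 \<le> inverse (norm_const M Z n) * (\<Prod>j=1..n. point_prob M Z j (\<eta> j))"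
    by (intro mult_nonneg_nonneg prod_nonneg) (simp_all add: norm_const_def point_prob_def)
  then show ?thesis
    using assms finite_partitions_of[of n]
    by (simp add: mult_measure_def measure_def emeasure_point_measure_finite)
qed

text \<open>Both sides contain the same product over \<open>A - B\<close>; what remains is
  commutativity. No division occurs, so vanishing factors do no harm.\<close>

lemma prod_cross_eq:
  fixes f g :: "'b \<Rightarrow> 'c::comm_monoid_mult"
  assumes "finite A" "B \<subseteq> A" "\<And>x. x \<in> A - B \<Longrightarrow> f x = g x"
  shows "prod f A * prod g B = prod g A * prod f B"
proof -
  have "prod f (A - B) = prod g (A - B)"
    by (rule prod.cong) (use assms(3) in auto)
  then show ?thesis
    using prod.subset_diff[OF assms(2,1), of f] prod.subset_diff[OF assms(2,1), of g]
    by (simp add: ac_simps)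
qed

theorem proposition1:
  fixes M :: "'a measure" and Z :: "nat \<Rightarrow> 'a \<Rightarrow> nat" and n :: nat
    and a :: "nat \<Rightarrow> nat \<Rightarrow> real"
    and uc uf :: "(nat \<Rightarrow> nat) \<Rightarrow> (nat \<Rightarrow> nat) \<Rightarrow> real"
  assumes n: "n \<ge> 1"
    and M: "prob_space M"
    and indep: "prob_space.indep_vars M (\<lambda>_. count_space UNIV) Z {1..}"
    and a: "a = point_prob M Z"
    and c_pos: "norm_const M Z n > 0"
    and rates: "cf_rates n uc uf"
    and uf_nz: "\<And>\<eta> i j. \<eta> \<in> partitions_of n \<Longrightarrow> coag_admissible \<eta> i j \<Longrightarrow>
        uf (coag \<eta> i j) \<eta> \<noteq> 0"
    and den_neq: "\<And>\<eta> i j. \<eta> \<in> partitions_of n \<Longrightarrow> i \<noteq> j \<Longrightarrow> coag_admissible \<eta> i j \<Longrightarrow>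
        a i (\<eta> i) * a j (\<eta> j) * a (i + j) (\<eta> (i + j)) \<noteq> 0"
    and den_eq: "\<And>\<eta> i. \<eta> \<in> partitions_of n \<Longrightarrow> coag_admissible \<eta> i i \<Longrightarrow>
        a i (\<eta> i) * a (2 * i) (\<eta> (2 * i)) \<noteq> 0"
    and q: "\<And>\<eta> i j. \<eta> \<in> partitions_of n \<Longrightarrow> coag_admissible \<eta> i j \<Longrightarrow>
        rate_ratio uc uf \<eta> i j =
          (if i \<noteq> j then
             (a i (\<eta> i - 1) * a j (\<eta> j - 1) * a (i + j) (\<eta> (i + j) + 1))
             / (a i (\<eta> i) * a j (\<eta> j) * a (i + j) (\<eta> (i + j)))
           else
             (a i (\<eta> i - 2) * a (2 * i) (\<eta> (2 * i) + 1))
             / (a i (\<eta> i) * a (2 * i) (\<eta> (2 * i))))"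
  shows "reversible_wrt (mult_measure M Z n) n uc uf"
  unfolding reversible_wrt_def
proof (intro ballI allI impI)
  fix \<eta> i j
  assume \<eta>: "\<eta> \<in> partitions_of n" and adm: "coag_admissible \<eta> i j"
  define \<zeta> where "\<zeta> = coag \<eta> i j"
  \<comment> \<open>Indexing by a set treats both cases at once: for \<open>i = j\<close> it
    collapses to \<open>i\<close> and \<open>2 * i\<close>.\<close>
  define N where "N = (\<Prod>m\<in>{i, j, i + j}. a m (\<zeta> m))"
  define D where "D = (\<Prod>m\<in>{i, j, i + j}. a m (\<eta> m))"
  have \<zeta>: "\<zeta> \<in> partitions_of n"
    unfolding \<zeta>_def by (rule coag_mem[OF \<eta> adm])
  have cross: "(\<Prod>m=1..n. a m (\<zeta> m)) * D = (\<Prod>m=1..n. a m (\<eta> m)) * N"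
    unfolding N_def D_def
    by (rule prod_cross_eq)
      (use coag_admissible_support[OF \<eta> adm] in \<open>auto simp: \<zeta>_def coag_def\<close>)
  have "D \<noteq> 0 \<and> rate_ratio uc uf \<eta> i j = N / D"
  proof (cases "i = j")
    case True
    \<comment> \<open>Positivity separates \<open>i\<close> from \<open>i + i\<close>, so the
      product has exactly two factors.\<close>
    have "i \<ge> 1" using adm by (simp add: coag_admissible_def)
    then show ?thesis
      using True q[OF \<eta> adm] den_eq[OF \<eta>, of i] adm
      by (simp add: N_def D_def \<zeta>_def coag_def numeral_2_eq_2)
  next
    case False
    have "i \<ge> 1" "j \<ge> 1" using adm by (simp_all add: coag_admissible_def)
    then show ?thesis
      using False q[OF \<eta> adm] den_neq[OF \<eta> False adm]
      by (simp add: N_def D_def \<zeta>_def coag_def mult.assoc)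
  qed
  then have D: "D \<noteq> 0" and "uc \<eta> \<zeta> / uf \<zeta> \<eta> = N / D"
    by (simp_all add: rate_ratio_def \<zeta>_def)
  \<comment> \<open>Clearing denominators needs \<open>uf_nz\<close>, because division by zero
    yields zero in HOL.\<close>
  then have "uc \<eta> \<zeta> * D = N * uf \<zeta> \<eta>"
    using uf_nz[OF \<eta> adm] by (simp add: \<zeta>_def frac_eq_eq)
  \<comment> \<open>The factor \<open>D\<close> is carried along so that \<open>cross\<close> can
    exchange \<open>N\<close> for \<open>D\<close>; it is cancelled afterwards.\<close>
  then have "(\<Prod>m=1..n. a m (\<eta> m)) * uc \<eta> \<zeta> * D = (\<Prod>m=1..n. a m (\<zeta> m)) * uf \<zeta> \<eta> * D"
    using cross by (metis mult.assoc mult.commute)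
  then have "(\<Prod>m=1..n. a m (\<eta> m)) * uc \<eta> \<zeta> = (\<Prod>m=1..n. a m (\<zeta> m)) * uf \<zeta> \<eta>"
    using D by simp
  then show "measure (mult_measure M Z n) {\<eta>} * uc \<eta> (coag \<eta> i j) =
      measure (mult_measure M Z n) {coag \<eta> i j} * uf (coag \<eta> i j) \<eta>"
    using measure_mult_measure_singleton[OF \<eta>, of M Z] measure_mult_measure_singleton[OF \<zeta>, of M Z]
    by (simp add: a \<zeta>_def mult.assoc)
qed

end
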